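(* Let $q$ be a prime power and $d$ an integer with $d>q^3-q^2+2$. Then the Hermitian polar space $\mathsf{H}(2d-1,q^2)$ has no ovoid.
   Context: $\mathsf{H}(2d-1,q^2)$ denotes the finite classical polar space of totally isotropic subspaces of a non-degenerate Hermitian form on $V(2d,q^2)$, viewed in $\mathrm{PG}(2d-1,q^2)$; it has rank $d$ and its generators are the totally isotropic subspaces of projective dimension $d-1$. An ovoid of a finite polar space is a set $\mathcal{O}$ of points such that every generator meets $\mathcal{O}$ in exactly one point. *)

theory Defs
  imports "HOL-Number_Theory.Prime_Powers" "HOL-Library.Cardinality"
begin

text \<open>
  The polar space \<open>H(2d-1, q\<^sup>2)\<close>. The scalars are a field type with exactly \<open>q\<^sup>2\<close> elements, so
  that the involution of the Hermitian form is \<open>c \<mapsto> c ^ q\<close>; semilinearity of \<open>h\<close> in its second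
  argument follows from \<open>h_linear\<close> and \<open>h_hermitian\<close>. The dimensions used by \<open>dim\<close> are vector space
  dimensions, one more than the projective dimensions. Since \<open>dim\<close> is \<open>0\<close> on infinite-dimensional
  spaces, \<open>d_pos\<close> and \<open>dim_space\<close> together say that the space is finite-dimensional.
\<close>

locale hermitian_polar_space = vector_space scale
  for scale :: "'a::field \<Rightarrow> 'v::ab_group_add \<Rightarrow> 'v" +
  fixes h :: "'v \<Rightarrow> 'v \<Rightarrow> 'a"
    and q d :: nat
  assumes card_field: "CARD('a) = q ^ 2"
    and d_pos: "d > 0"
    and dim_space: "dim (UNIV :: 'v set) = 2 * d"
    and h_linear: "\<And>y. Vector_Spaces.linear scale (*) (\<lambda>x. h x y)"
    and h_hermitian: "\<And>x y. h y x = h x y ^ q"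
    and h_nondegenerate: "\<And>x. (\<And>y. h x y = 0) \<Longrightarrow> x = 0"
begin

definition totally_isotropic :: "'v set \<Rightarrow> bool" where
  "totally_isotropic U \<longleftrightarrow> subspace U \<and> (\<forall>x\<in>U. \<forall>y\<in>U. h x y = 0)"

definition points :: "'v set set" where
  "points = {P. totally_isotropic P \<and> dim P = 1}"

definition generators :: "'v set set" where
  "generators = {G. totally_isotropic G \<and> dim G = d}"

definition ovoid :: "'v set set \<Rightarrow> bool" where
  "ovoid \<O> \<longleftrightarrow> \<O> \<subseteq> points \<and> (\<forall>G\<in>generators. \<exists>!P. P \<in> \<O> \<and> P \<subseteq> G)"

end

end

theory Submission
  imports Defs "HOL-Computational_Algebra.Polynomial"
begin

text \<open>
  Idea. If \<open>U\<close> is totally isotropic of dimension \<open>k\<close> and contains no point of the ovoid, then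
  \<open>U\<^sup>\<bottom> / U\<close> inherits an ovoid, so \<open>U\<^sup>\<bottom>\<close> contains \<open>q\<^bsup>2(d - k) - 1\<^esup> + 1\<close> points of the ovoid. Let \<open>W\<close> be
  a subspace of dimension \<open>k + 3\<close> with radical \<open>U\<close> that contains \<open>t \<ge> 2\<close> points of the ovoid. Double
  counting the orthogonal pairs formed by an isotropic vector of \<open>W\<^sup>\<bottom> - U\<close> and a point of the ovoid in
  \<open>U\<^sup>\<bottom>\<close> shows that exactly \<open>(q\<^bsup>2(d - k) - 4\<^esup> - 1) (t + q\<^sup>2 - 1)\<close> points \<open>P\<close> of the ovoid outside \<open>W\<close> are
  such that the radical of \<open>\<langle>W, P\<rangle>\<close> has dimension \<open>k + 1\<close>. Since this number is positive if
  \<open>d - k \<ge> 3\<close>, we can start from a nondegenerate plane with three points of the ovoid and enlarge it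
  step by step until \<open>t \<ge> q\<^sup>3 - q\<^sup>2 + 3\<close>; but then these points and the \<open>t\<close> points in \<open>W\<close> together
  outnumber the points of the ovoid in \<open>U\<^sup>\<bottom>\<close>.
\<close>

section \<open>Auxiliary counting: roots of polynomials and splitting a finite sum\<close>

lemma card_power_eq_le:
  fixes c :: "'a::idom"
  assumes "n > 0"
  shows "card {a. a ^ n = c} \<le> n"
proof -
  let ?p = "monom 1 n + [:- c:]"
  have deg: "degree ?p = n"
    using assms by (subst degree_add_eq_left) (simp_all add: degree_monom_eq)
  then have "?p \<noteq> 0"
    using assms by auto
  then have "card {a. poly ?p a = 0} \<le> n"
    using card_poly_roots_bound deg by metis
  then show ?thesis
    by (simp add: poly_monom)
qed

text \<open>Stated over the integers so that the size of the remainder is a genuine difference; it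
  later separates the three kinds of ovoid points in the double count.\<close>

lemma sum_card_Diff_Diff:
  assumes "A \<subseteq> X" "B \<subseteq> X" "A \<inter> B = {}" "finite X"
  shows "(\<Sum>x\<in>X. f x) = (\<Sum>x\<in>A. f x) + (\<Sum>x\<in>B. f x) + (\<Sum>x\<in>X - A - B. f x :: int)"
    and "int (card (X - A - B)) = int (card X) - int (card A) - int (card B)"
proof -
  show "(\<Sum>x\<in>X. f x) = (\<Sum>x\<in>A. f x) + (\<Sum>x\<in>B. f x) + (\<Sum>x\<in>X - A - B. f x)"
  proof -
    have "B \<subseteq> X - A"
      using assms by blast
    then show ?thesis
      using sum.subset_diff[of A X f] sum.subset_diff[of B "X - A" f] assms by simp
  qed
  have "card (X - A - B) = card (X - A) - card B" "card (X - A) = card X - card A"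
    "card B \<le> card (X - A)" "card A \<le> card X"
    using assms by (auto intro!: card_Diff_subset card_mono intro: finite_subset)
  then show "int (card (X - A - B)) = int (card X) - int (card A) - int (card B)"
    by simp
qed

context hermitian_polar_space
begin

section \<open>First properties of the form and of the finite vector space\<close>

lemma h_add: "h (x + x') y = h x y + h x' y"
  using module_hom.add[of scale "(*)" "\<lambda>x. h x y"] h_linear by (simp add: linear_iff_module_hom)

lemma h_scale: "h (scale c x) y = c * h x y"
  using module_hom.scale[of scale "(*)" "\<lambda>x. h x y"] h_linear by (simp add: linear_iff_module_hom)

lemma h_zero: "h 0 y = 0"
  using h_scale[of 0 0 y] by simp

text \<open>An infinite type has \<open>CARD\<close> equal to \<open>0\<close>, so
  \<open>q = 0\<close> must be excluded through the form: it would make \<open>h\<close> constantly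
  \<open>1\<close>, against \<open>h 0 0 = 0\<close>. With finiteness known, \<open>q < 2\<close>
  leaves at most one scalar.\<close>

lemma q_ge_2: "q \<ge> 2"
proof (rule ccontr)
  assume "\<not> q \<ge> 2"
  then have "q = 0 \<or> q = 1"
    by auto
  then have "CARD('a) \<le> 1"
    using card_field by auto
  moreover have "finite (UNIV :: 'a set)"
  proof (rule ccontr)
    assume "infinite (UNIV :: 'a set)"
    then have "q = 0"
      using card_field by simp
    then have "h y x = 1" for x y
      using h_hermitian by simp
    then show False
      using h_zero[of 0] by simp
  qed
  ultimately have "(0::'a) = 1"
    by (metis One_nat_def UNIV_I card_le_Suc0_iff_eq)
  then show False
    by simp
qed

lemma finite_field: "finite (UNIV :: 'a set)"
  using card_field q_ge_2 by (intro card_ge_0_finite) simp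

lemma h_eq_0_commute: "h x y = 0 \<longleftrightarrow> h y x = 0"
  using h_hermitian[of x y] h_hermitian[of y x] q_ge_2 by (auto simp: power_0_left)

text \<open>\<open>finite_dimensional_vector_space\<close> takes a basis as a parameter, so one
  finite basis is fixed by choice to interpret it inside this locale.\<close>

definition basis :: "'v set" where
  "basis = (SOME B. independent B \<and> span B = UNIV \<and> finite B)"

lemma basis: "independent basis" "span basis = UNIV" "finite basis"
proof -
  obtain B where B: "independent B" "span B = (UNIV :: 'v set)"
    using maximal_independent_subset[of UNIV] by (metis UNIV_I subset_antisym subset_UNIV)
  then have "card B = 2 * d"
    using dim_space dim_eq_card[of B UNIV] by simp
  then have "finite B"
    using d_pos by (intro card_ge_0_finite) simp
  with B have "\<exists>B. independent B \<and> span B = UNIV \<and> finite B"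
    by blast
  then have "independent basis \<and> span basis = UNIV \<and> finite basis"
    unfolding basis_def by (rule someI_ex)
  then show "independent basis" "span basis = UNIV" "finite basis"
    by auto
qed

sublocale finite_dimensional_vector_space scale basis
  by unfold_locales (use basis in auto)

lemma dim_space': "card basis = 2 * d"
  using dim_space by simp

text \<open>Unique coordinates along \<open>v\<close> and \<open>B\<close>. This counts a subspace
  one basis vector at a time, and later parametrises a subspace by a nonisotropic line and its
  orthogonal hyperplane.\<close>

lemma bij_betw_span_insert:
  assumes "subspace B" "v \<notin> B"
  shows "bij_betw (\<lambda>(a, b). scale a v + b) (UNIV \<times> B) (span (insert v B))"
proof (rule bij_betw_imageI)
  show "inj_on (\<lambda>(a, b). scale a v + b) (UNIV \<times> B)"
  proof (clarsimp simp: inj_on_def)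
    fix a b a' b'
    assume b: "b \<in> B" "b' \<in> B" and eq: "scale a v + b = scale a' v + b'"
    then have "scale (a - a') v = b' - b"
      by (simp add: algebra_simps)
    then have "scale (a - a') v \<in> B"
      using assms b by (simp add: subspace_diff)
    moreover have "a = a'" if "scale (a - a') v \<in> B"
    proof (rule ccontr)
      assume "a \<noteq> a'"
      then have "v = scale (inverse (a - a')) (scale (a - a') v)"
        by simp
      then show False
        using assms that subspace_scale by metis
    qed
    ultimately show "a = a' \<and> b = b'"
      using eq by auto
  qed
  have "x \<in> (\<lambda>(a, b). scale a v + b) ` (UNIV \<times> B)" if x: "x \<in> span (insert v B)" for x
  proof -
    obtain k where "x - scale k v \<in> span B"
      using x span_breakdown_eq[of x v B] by auto
    then have "(k, x - scale k v) \<in> UNIV \<times> B"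
      using assms span_eq_iff by blast
    then show ?thesis
      by (force intro!: rev_image_eqI)
  qed
  moreover have "scale a v + b \<in> span (insert v B)" if "b \<in> B" for a b
    using that by (intro span_add span_scale span_base) auto
  ultimately show "(\<lambda>(a, b). scale a v + b) ` (UNIV \<times> B) = span (insert v B)"
    by auto
qed

lemma card_subspace:
  assumes "subspace A"
  shows "finite A" "card A = q ^ (2 * dim A)"
proof -
  have *: "finite (span B) \<and> card (span B) = q ^ (2 * card B)" if "finite B" "independent B" for B
    using that
  proof (induction B rule: finite_induct)
    case empty
    then show ?case
      by simp
  next
    case (insert b B)
    then have B: "b \<notin> span B" "independent B"
      by (auto simp: independent_insert)
    then have "bij_betw (\<lambda>(a, c). scale a b + c) (UNIV \<times> span B) (span (insert b (span B)))"
      by (intro bij_betw_span_insert) auto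
    moreover have "span (insert b (span B)) = span (insert b B)"
      by (simp add: span_insert span_span)
    ultimately have bij: "bij_betw (\<lambda>(a, c). scale a b + c) ((UNIV :: 'a set) \<times> span B) (span (insert b B))"
      by simp
    then have "card (span (insert b B)) = card ((UNIV :: 'a set) \<times> span B)"
      by (simp add: bij_betw_same_card)
    also have "\<dots> = q ^ (2 * card (insert b B))"
      using insert B card_field by (simp add: card_cartesian_product power_add power2_eq_square)
    finally show ?case
      using bij_betw_finite[OF bij] insert B finite_field by simp
  qed
  obtain B where "finite B" "independent B" "span B = A" "card B = dim A"
    using basis_subspace_exists[OF assms] by metis
  with *[of B] show "finite A" "card A = q ^ (2 * dim A)"
    by auto
qed

lemma finite_vectors: "finite (X :: 'v set)"
  using card_subspace(1)[OF subspace_UNIV] finite_subset subset_UNIV by blast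

text \<open>Grassmann's formula with the sum bounded by \<open>W'\<close>. With \<open>W\<close> a
  hyperplane of \<open>W'\<close>, intersecting with \<open>W\<close> costs at most one
  dimension.\<close>

lemma dim_le_dim_Int:
  assumes "subspace A" "subspace W" "A \<subseteq> W'" "W \<subseteq> W'" "subspace W'"
  shows "dim A + dim W \<le> dim (A \<inter> W) + dim W'"
proof -
  have "{x + y |x y. x \<in> A \<and> y \<in> W} \<subseteq> W'"
    using assms by (auto intro: subspace_add)
  then have "dim {x + y |x y. x \<in> A \<and> y \<in> W} \<le> dim W'"
    by (rule dim_subset)
  then show ?thesis
    using dim_sums_Int[OF assms(1,2)] by simp
qed

subsection \<open>Orthogonal subspaces\<close>

text \<open>The vector stands in the first argument, where the form is linear; by
  \<open>h_eq_0_commute\<close> the other order gives the same set.\<close>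

definition perp :: "'v set \<Rightarrow> 'v set" where
  "perp S = {v. \<forall>s\<in>S. h v s = 0}"

lemma perpD: "v \<in> perp S \<Longrightarrow> s \<in> S \<Longrightarrow> h v s = 0"
  by (simp add: perp_def)

lemma subspace_perp: "subspace (perp S)"
  by (auto simp: subspace_def perp_def h_zero h_add h_scale)

lemma subset_perp_commute: "S \<subseteq> perp T \<longleftrightarrow> T \<subseteq> perp S"
  using h_eq_0_commute by (auto simp: perp_def)

lemma subset_perp_perp: "S \<subseteq> perp (perp S)"
  using subset_perp_commute[of S "perp S"] by simp

lemma perp_span: "perp (span S) = perp S"
proof
  show "perp (span S) \<subseteq> perp S"
    by (auto simp: perp_def span_base)
  have "span S \<subseteq> perp (perp S)"
    by (rule span_minimal[OF subset_perp_perp subspace_perp])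
  then show "perp S \<subseteq> perp (span S)"
    by (simp add: subset_perp_commute)
qed

lemma perp_Un: "perp (S \<union> T) = perp S \<inter> perp T"
  by (auto simp: perp_def)

lemma perp_UNIV: "perp UNIV = {0}"
  using h_nondegenerate h_zero by (auto simp: perp_def)

lemma perp_empty: "perp {} = UNIV"
  by (auto simp: perp_def)

text \<open>Subtracting the multiple \<open>h a x / h v x\<close> of \<open>v\<close> from
  \<open>a\<close> makes it orthogonal to \<open>x\<close>. For \<open>x = v\<close> this is the
  orthogonal splitting along a nonisotropic vector.\<close>

lemma span_insert_Int_perp:
  assumes "subspace A" "v \<in> A" "h v x \<noteq> 0"
  shows "span (insert v (A \<inter> perp {x})) = A"
proof
  show "span (insert v (A \<inter> perp {x})) \<subseteq> A"
    using assms by (intro span_minimal) auto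
  show "A \<subseteq> span (insert v (A \<inter> perp {x}))"
  proof
    fix a assume a: "a \<in> A"
    let ?k = "h a x / h v x"
    have "h (a - scale ?k v) x = h a x - ?k * h v x"
      using h_add[of "a - scale ?k v" "scale ?k v" x] h_scale[of ?k v x] by (simp add: algebra_simps)
    then have "a - scale ?k v \<in> A \<inter> perp {x}"
      using assms a by (auto simp: perp_def intro!: subspace_diff subspace_scale)
    then show "a \<in> span (insert v (A \<inter> perp {x}))"
      by (auto simp: span_insert intro!: span_base)
  qed
qed

lemma dim_Int_perp_singleton:
  assumes "subspace A"
  shows "dim A = (if A \<subseteq> perp {x} then dim (A \<inter> perp {x}) else dim (A \<inter> perp {x}) + 1)"
proof (cases "A \<subseteq> perp {x}")
  case True
  then show ?thesis
    by (simp add: Int_absorb2)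
next
  case False
  then obtain v where v: "v \<in> A" "h v x \<noteq> 0"
    by (auto simp: perp_def)
  have "v \<notin> span (A \<inter> perp {x})"
    unfolding span_eq_iff[THEN iffD2, OF subspace_inter[OF assms subspace_perp]]
    using v by (simp add: perp_def)
  then show ?thesis
    using False dim_insert[of v "A \<inter> perp {x}"] span_insert_Int_perp[OF assms v] dim_span by metis
qed

lemma dim_perp_Un_le:
  assumes "finite C"
  shows "dim (perp B) \<le> dim (perp (B \<union> C)) + card C"
  using assms
proof (induction C rule: finite_induct)
  case (insert c C)
  have "perp (B \<union> insert c C) = perp (B \<union> C) \<inter> perp {c}"
    by (auto simp: perp_def)
  then have "dim (perp (B \<union> C)) \<le> dim (perp (B \<union> insert c C)) + 1"
    using dim_Int_perp_singleton[OF subspace_perp, of "B \<union> C" c] by (auto split: if_splits)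
  with insert show ?case
    by simp
qed simp

text \<open>Extend a basis \<open>B\<close> of \<open>W\<close> to a basis \<open>C\<close> of the
  whole space. Each vector lowers the dimension of the orthogonal space by at most one, and all of
  \<open>C\<close> together lower it from \<open>2 * d\<close> to \<open>0\<close> by nondegeneracy,
  so no vector can lower it by less.\<close>

lemma dim_perp:
  assumes "subspace W"
  shows "dim (perp W) + dim W = 2 * d"
proof -
  obtain B where B: "finite B" "independent B" "span B = W" "card B = dim W"
    using basis_subspace_exists[OF assms] by metis
  obtain C where C: "B \<subseteq> C" "independent C" "span C = UNIV"
    using maximal_independent_subset_extend[of B UNIV] B by (metis subset_UNIV top.extremum_uniqueI)
  have fin: "finite C" "card C = 2 * d"
    using C dim_span_eq_card_independent[of C] dim_space by (auto simp: finiteI_independent)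
  have "dim (perp B) \<le> dim (perp (B \<union> C)) + card (C - B)"
    using dim_perp_Un_le[of "C - B" B] fin by simp
  moreover have "perp (B \<union> C) = {0}"
    using C perp_span[of C] perp_UNIV by (metis sup.absorb2)
  moreover have "card (C - B) + card B = 2 * d"
    using fin B C by (metis card_mono card_Diff_subset le_add_diff_inverse2)
  moreover have "2 * d \<le> dim (perp B) + card B"
    using dim_perp_Un_le[of B "{}"] B dim_space by (simp add: perp_empty)
  moreover have "perp W = perp B"
    using B perp_span[of B] by simp
  ultimately show ?thesis
    using B(4) by simp
qed

lemma perp_perp:
  assumes "subspace W"
  shows "perp (perp W) = W"
proof -
  have "W \<subseteq> perp (perp W)"
    by (rule subset_perp_perp)
  moreover have "dim (perp (perp W)) = dim W"
    using dim_perp[OF assms] dim_perp[OF subspace_perp, of W] by simp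
  ultimately show ?thesis
    using subspace_dim_equal[OF assms subspace_perp, of "perp W"] by simp
qed

text \<open>Since every scalar is a value of the form, applying \<open>h_hermitian\<close> twice
  yields \<open>power_q_q\<close>.\<close>

lemma h_surj: "\<exists>x y. h x y = c"
proof -
  obtain v :: 'v where "v \<in> basis"
    using dim_space' d_pos by fastforce
  then have "v \<noteq> 0"
    using basis dependent_zero by metis
  then obtain w where "h v w \<noteq> 0"
    using h_nondegenerate by blast
  then have "h (scale (c / h v w) v) w = c"
    by (simp add: h_scale)
  then show ?thesis
    by blast
qed

lemma power_q_q: "(c ^ q) ^ q = (c :: 'a)"
  using h_surj[of c] h_hermitian by metis

text \<open>For even \<open>q\<close>, raising \<open>- 1\<close> twice to the power
  \<open>q\<close> gives \<open>1\<close>, while \<open>power_q_q\<close> says that it gives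
  \<open>- 1\<close>; hence every scalar is its own negative.\<close>

lemma uminus_power_q: "(- c) ^ q = - (c ^ q :: 'a)"
proof (cases "even q")
  case True
  then have "- (1::'a) = 1"
    using power_q_q[of "- 1"] by simp
  then have "- c = c" for c :: 'a
    by (metis mult_minus1 mult_1)
  then show ?thesis
    by metis
qed simp

subsection \<open>Counting isotropic vectors\<close>

text \<open>The nonzero scalars fixed by the involution: all nonzero values \<open>h v v\<close> lie
  here.\<close>

definition fixed_units :: "'a set" where
  "fixed_units = {c. c ^ q = c \<and> c \<noteq> 0}"

text \<open>Two bounds meet. Fixed units are roots of \<open>c ^ (q - 1) = 1\<close>, so there are
  at most \<open>q - 1\<close>. The norm \<open>a ^ (q + 1)\<close> has fibres of size at most
  \<open>q + 1\<close> on \<open>(q - 1) * (q + 1)\<close> units, so its image has at least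
  \<open>q - 1\<close> elements.\<close>

lemma norm_image: "(\<lambda>a. a ^ (q + 1)) ` (- {0}) = fixed_units" (is "?N = _")
  and card_fixed_units: "card fixed_units = q - 1"
proof -
  have sub: "?N \<subseteq> fixed_units"
    by (auto simp: fixed_units_def power_q_q power_mult_distrib)
  have fin: "finite (X :: 'a set)" for X
    using finite_field finite_subset subset_UNIV by blast
  have "fixed_units \<subseteq> {c. c ^ (q - 1) = 1}"
  proof
    fix c assume "c \<in> fixed_units"
    then have c: "c ^ q = c" "c \<noteq> 0"
      by (auto simp: fixed_units_def)
    moreover have "c ^ q = c * c ^ (q - 1)"
      using q_ge_2 by (metis One_nat_def Suc_le_D Suc_1 diff_Suc_1 power_Suc)
    ultimately show "c \<in> {c. c ^ (q - 1) = 1}"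
      by simp
  qed
  then have le1: "card fixed_units \<le> q - 1"
    using q_ge_2 by (intro order_trans[OF card_mono[OF fin] card_power_eq_le]) auto
  have "- {0} = (\<Union>c\<in>?N. {a. a ^ (q + 1) = c} - {0})"
    by auto
  then have "card (- {0} :: 'a set) \<le> (\<Sum>c\<in>?N. card ({a. a ^ (q + 1) = c} - {0}))"
    using card_UN_le[OF fin] by metis
  also have "\<dots> \<le> (\<Sum>c\<in>?N. q + 1)"
    by (intro sum_mono order_trans[OF card_mono card_power_eq_le]) (auto intro: fin)
  finally have "card (- {0} :: 'a set) \<le> card ?N * (q + 1)"
    by simp
  moreover have "card (- {0} :: 'a set) = (q - 1) * (q + 1)"
    using card_field finite_field by (simp add: Compl_eq_Diff_UNIV card_Diff_singleton power2_eq_square algebra_simps)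
  ultimately have le2: "q - 1 \<le> card ?N"
    by (metis add_gr_0 less_one mult_le_cancel2)
  have "card ?N \<le> card fixed_units"
    using sub by (intro card_mono fin)
  with le1 le2 show "card fixed_units = q - 1"
    by simp
  with le2 show "?N = fixed_units"
    using sub by (intro card_seteq fin) auto
qed

text \<open>A polynomial of degree \<open>q\<close> cannot vanish at all \<open>q ^ 2\<close>
  scalars.\<close>

lemma exists_trace_nonzero: "\<exists>z :: 'a. z ^ q + z \<noteq> 0"
proof (rule ccontr)
  assume no: "\<not> ?thesis"
  let ?p = "monom (1::'a) q + monom 1 1"
  have "degree ?p = q"
    using q_ge_2 by (subst degree_add_eq_left) (simp_all add: degree_monom_eq)
  moreover from this have "?p \<noteq> 0"
    using q_ge_2 by auto
  ultimately have "card {a. poly ?p a = 0} \<le> q"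
    using card_poly_roots_bound by metis
  moreover have "{a. poly ?p a = 0} = UNIV"
    using no by (auto simp: poly_monom)
  moreover have "q * q > q"
    using q_ge_2 by simp
  ultimately show False
    using card_field by (simp add: power2_eq_square)
qed

text \<open>Polarisation: if all vectors of \<open>A\<close> were isotropic, \<open>h x y\<close>
  could be scaled to any \<open>z\<close>, and expanding the form at the sum would force the trace
  \<open>z + z ^ q\<close> to vanish.\<close>

lemma exists_nonisotropic:
  assumes "subspace A" "\<not> A \<subseteq> perp A"
  shows "\<exists>v\<in>A. h v v \<noteq> 0"
proof (rule ccontr)
  assume "\<not> ?thesis"
  then have iso: "h v v = 0" if "v \<in> A" for v
    using that by blast
  obtain x y where xy: "x \<in> A" "y \<in> A" "h x y \<noteq> 0"
    using assms by (auto simp: perp_def)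
  obtain z :: 'a where z: "z ^ q + z \<noteq> 0"
    using exists_trace_nonzero by blast
  define c where "c = z / h x y"
  let ?x = "scale c x"
  have z_eq: "h ?x y = z"
    using xy by (simp add: h_scale c_def)
  have mem: "?x \<in> A" "?x + y \<in> A"
    using xy assms by (auto intro: subspace_add subspace_scale)
  have "h (?x + y) (?x + y) = h ?x (?x + y) + h y (?x + y)"
    by (rule h_add)
  \<comment> \<open>Additivity is available in the first argument only, so the arguments are swapped
    before expanding again.\<close>
  also have "\<dots> = h (?x + y) ?x ^ q + h (?x + y) y ^ q"
    by (simp only: h_hermitian[of ?x "?x + y"] h_hermitian[of y "?x + y"])
  also have "\<dots> = h y ?x ^ q + h ?x y ^ q"
    using iso mem xy by (simp add: h_add)
  also have "\<dots> = z + z ^ q"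
    using z_eq h_hermitian[of y ?x] by (simp add: power_q_q)
  finally show False
    using iso[OF mem(2)] z by (simp add: add.commute)
qed

definition isotropic_vectors :: "'v set \<Rightarrow> 'v set" where
  "isotropic_vectors A = {v \<in> A. h v v = 0}"

text \<open>Scaling by \<open>a\<close> multiplies \<open>h b b\<close> by the norm of
  \<open>a\<close>, and by \<open>norm_image\<close> norms realise every quotient of two fixed
  units.\<close>

lemma card_value_eq:
  assumes "subspace B" "c \<in> fixed_units" "c' \<in> fixed_units"
  shows "card {b \<in> B. h b b = c} = card {b \<in> B. h b b = c'}"
proof -
  have le: "card {b \<in> B. h b b = c} \<le> card {b \<in> B. h b b = c'}"
    if "c \<in> fixed_units" "c' \<in> fixed_units" for c c'
  proof -
    have "c' / c \<in> fixed_units"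
      using that by (auto simp: fixed_units_def power_divide)
    then obtain a where a: "a \<noteq> 0" "a ^ (q + 1) = c' / c"
      using norm_image by (metis (no_types, lifting) ComplD imageE singletonI)
    have "h (scale a b) (scale a b) = a ^ (q + 1) * h b b" for b
    proof -
      have "h b (scale a b) = a ^ q * h b b"
        using h_hermitian[of b "scale a b"] h_hermitian[of b b] by (simp add: h_scale power_mult_distrib)
      then show ?thesis
        by (simp add: h_scale)
    qed
    then have "scale a ` {b \<in> B. h b b = c} \<subseteq> {b \<in> B. h b b = c'}"
      using a assms that by (auto simp: subspace_scale fixed_units_def)
    moreover have "inj_on (scale a) {b \<in> B. h b b = c}"
      using a by (auto simp: inj_on_def)
    ultimately show ?thesis
      by (intro card_inj_on_le[OF _ _ finite_vectors])
  qed
  show ?thesis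
    using le assms by (intro antisym) auto
qed

text \<open>The vector \<open>scale a v + b\<close> is isotropic iff \<open>h b b\<close> is minus
  the norm of \<open>a\<close> times \<open>h v v\<close>. For \<open>a = 0\<close> this gives the
  isotropic vectors of \<open>B\<close>; each of the other \<open>q ^ 2 - 1\<close> scalars gives
  the same number \<open>K\<close>. Splitting \<open>B\<close> by the value of \<open>h b b\<close>
  expresses \<open>(q - 1) * K\<close>, which eliminates \<open>K\<close>.\<close>

lemma card_isotropic_vectors_split:
  assumes "subspace A" "v \<in> A" "h v v \<noteq> 0"
  defines "B \<equiv> A \<inter> perp {v}"
  shows "int (card (isotropic_vectors A)) = (int q + 1) * int (q ^ (2 * dim B)) - int q * int (card (isotropic_vectors B))"
proof -
  have B: "subspace B" "v \<notin> B" "span (insert v B) = A"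
    using subspace_inter[OF assms(1) subspace_perp] span_insert_Int_perp[OF assms(1-3)] assms(3)
    by (auto simp: B_def perpD)
  have fin: "finite (X :: 'a set)" for X
    using finite_field finite_subset subset_UNIV by blast
  have fixed: "h x x ^ q = h x x" for x
    using h_hermitian[of x x] by simp
  define K where "K = card {b \<in> B. h b b = - h v v}"
  have mem: "- h v v \<in> fixed_units"
    using assms fixed by (simp add: fixed_units_def uminus_power_q)
  have K: "card {b \<in> B. h b b = c} = K" if "c \<in> fixed_units" for c
    unfolding K_def by (rule card_value_eq[OF B(1) that mem])
  have "B = (\<Union>c\<in>insert 0 fixed_units. {b \<in> B. h b b = c})"
    using fixed by (auto simp: fixed_units_def)
  then have "card B = (\<Sum>c\<in>insert 0 fixed_units. card {b \<in> B. h b b = c})"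
    using card_UN_disjoint[OF fin, of "insert 0 fixed_units" "\<lambda>c. {b \<in> B. h b b = c}"] finite_vectors by auto
  also have "\<dots> = card (isotropic_vectors B) + (\<Sum>c\<in>fixed_units. card {b \<in> B. h b b = c})"
    using fin by (subst sum.insert) (auto simp: fixed_units_def isotropic_vectors_def)
  also have "\<dots> = card (isotropic_vectors B) + (q - 1) * K"
    using K by (simp add: card_fixed_units)
  finally have card_B: "q ^ (2 * dim B) = card (isotropic_vectors B) + (q - 1) * K"
    using card_subspace[OF B(1)] by simp
  let ?f = "\<lambda>(a, b). scale a v + b"
  have val: "h (scale a v + b) (scale a v + b) = a ^ (q + 1) * h v v + h b b" if "b \<in> B" for a b
  proof -
    have 0: "h b v = 0" "h v b = 0"
      using that h_eq_0_commute by (auto simp: B_def perp_def)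
    have "h v (scale a v + b) = a ^ q * h v v"
      using h_hermitian[of v "scale a v + b"] 0 fixed by (simp add: h_add h_scale power_mult_distrib)
    moreover have "h b (scale a v + b) = h b b"
      using h_hermitian[of b "scale a v + b"] 0 fixed by (simp add: h_add h_scale)
    ultimately show ?thesis
      by (simp add: h_add h_scale)
  qed
  let ?S = "SIGMA a:UNIV. {b \<in> B. h b b = - (a ^ (q + 1) * h v v)}"
  have bij: "bij_betw ?f (UNIV \<times> B) A"
    using bij_betw_span_insert[OF B(1,2)] B(3) by simp
  have "bij_betw ?f ?S (isotropic_vectors A)"
  proof (rule bij_betw_subset[OF bij])
    show "?f ` ?S = isotropic_vectors A"
    proof
      show "?f ` ?S \<subseteq> isotropic_vectors A"
        using val bij by (auto simp: isotropic_vectors_def bij_betw_def)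
      show "isotropic_vectors A \<subseteq> ?f ` ?S"
      proof
        fix x assume x: "x \<in> isotropic_vectors A"
        then have "x \<in> ?f ` (UNIV \<times> B)"
          using bij by (simp add: isotropic_vectors_def bij_betw_def)
        then obtain a b where ab: "b \<in> B" "x = scale a v + b"
          by auto
        then have "a ^ (q + 1) * h v v + h b b = 0"
          using val[of b a] x by (simp add: isotropic_vectors_def)
        then have "(a, b) \<in> ?S"
          using ab(1) by (simp add: eq_neg_iff_add_eq_0 add.commute)
        then show "x \<in> ?f ` ?S"
          using ab(2) by force
      qed
    qed
  qed auto
  then have "card (isotropic_vectors A) = card ?S"
    by (simp add: bij_betw_same_card)
  also have "\<dots> = (\<Sum>a\<in>UNIV. card {b \<in> B. h b b = - (a ^ (q + 1) * h v v)})"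
    using finite_field by (subst card_SigmaI) (auto intro: finite_vectors)
  also have "\<dots> = card (isotropic_vectors B) + (\<Sum>a\<in>- {0}. card {b \<in> B. h b b = - (a ^ (q + 1) * h v v)})"
    using finite_field by (subst sum.remove[of _ 0]) (auto simp: isotropic_vectors_def Compl_eq_Diff_UNIV)
  also have "(\<Sum>a\<in>- {0}. card {b \<in> B. h b b = - (a ^ (q + 1) * h v v)}) = (\<Sum>a\<in>- {0 :: 'a}. K)"
  proof (intro sum.cong refl K)
    fix a :: 'a assume "a \<in> - {0}"
    then have "a ^ (q + 1) \<in> fixed_units"
      using norm_image by blast
    then show "- (a ^ (q + 1) * h v v) \<in> fixed_units"
      using assms fixed by (simp add: fixed_units_def uminus_power_q power_mult_distrib power_q_q)
  qed
  also have "\<dots> = (q ^ 2 - 1) * K"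
    using card_field finite_field by (simp add: Compl_eq_Diff_UNIV card_Diff_singleton)
  also have "\<dots> = (q + 1) * ((q - 1) * K)"
    by (simp add: power2_eq_square algebra_simps)
  finally have "int (card (isotropic_vectors A)) = int (card (isotropic_vectors B)) + (int q + 1) * int ((q - 1) * K)"
    by (simp only: of_nat_add of_nat_mult of_nat_1)
  moreover have "int ((q - 1) * K) = int (q ^ (2 * dim B)) - int (card (isotropic_vectors B))"
    using card_B by linarith
  ultimately show ?thesis
    by algebra
qed

text \<open>Nonisotropic vectors are split off until the subspace is totally isotropic. This keeps
  the radical \<open>A \<inter> perp A\<close>, so the final subspace is the radical itself. The
  factor \<open>q\<close> on the left avoids exponents lowered by one.\<close>

lemma card_isotropic_vectors:
  assumes "subspace A"
  shows "int q * int (card (isotropic_vectors A))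
    = int q ^ (2 * dim A) + (int q - 1) * (- int q) ^ (dim A + dim (A \<inter> perp A))"
  using assms
proof (induction "dim A" arbitrary: A rule: less_induct)
  case less
  show ?case
  proof (cases "A \<subseteq> perp A")
    case True
    then have "isotropic_vectors A = A" "A \<inter> perp A = A"
      by (auto simp: isotropic_vectors_def perp_def)
    then show ?thesis
      using card_subspace[OF less.prems] by (simp add: algebra_simps flip: mult_2)
  next
    case False
    then obtain v where v: "v \<in> A" "h v v \<noteq> 0"
      using exists_nonisotropic[OF less.prems] by blast
    let ?B = "A \<inter> perp {v}"
    have sub: "subspace ?B"
      using less.prems subspace_perp subspace_inter by blast
    have dim: "dim A = Suc (dim ?B)"
      using dim_Int_perp_singleton[OF less.prems, of v] v by (auto simp: perp_def)
    have "perp A = perp (insert v ?B)"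
      using span_insert_Int_perp[OF less.prems v] perp_span by metis
    then have rad: "A \<inter> perp A = ?B \<inter> perp ?B"
      using v by (auto simp: perp_def)
    have "int q * int (card (isotropic_vectors A))
      = (int q + 1) * int q * int q ^ (2 * dim ?B) - int q * (int q * int (card (isotropic_vectors ?B)))"
      by (subst card_isotropic_vectors_split[OF less.prems v]) (simp add: algebra_simps)
    also have "int q * int (card (isotropic_vectors ?B)) = int q ^ (2 * dim ?B) + (int q - 1) * (- int q) ^ (dim ?B + dim (?B \<inter> perp ?B))"
      using less.hyps[of ?B] dim sub by simp
    finally show ?thesis
      by (simp add: dim rad algebra_simps power2_eq_square)
  qed
qed

subsection \<open>Totally isotropic subspaces\<close>

lemma totally_isotropic_iff: "totally_isotropic U \<longleftrightarrow> subspace U \<and> U \<subseteq> perp U"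
  by (auto simp: totally_isotropic_def perp_def)

lemma totally_isotropic_span: "X \<subseteq> perp X \<Longrightarrow> totally_isotropic (span X)"
  unfolding totally_isotropic_iff perp_span by (simp add: span_minimal subspace_perp)

lemma totally_isotropic_subset_perp: "totally_isotropic U \<Longrightarrow> A \<subseteq> U \<Longrightarrow> B \<subseteq> U \<Longrightarrow> A \<subseteq> perp B"
  by (auto simp: totally_isotropic_def perp_def)

lemma totally_isotropic_span_insert:
  assumes "totally_isotropic U" "v \<in> isotropic_vectors (perp U)"
  shows "totally_isotropic (span (insert v U))"
  using assms h_eq_0_commute
  by (intro totally_isotropic_span) (auto simp: totally_isotropic_def isotropic_vectors_def perp_def)

lemma subset_isotropic_vectors: "totally_isotropic U \<Longrightarrow> U \<subseteq> A \<Longrightarrow> U \<subseteq> isotropic_vectors A"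
  by (auto simp: totally_isotropic_def isotropic_vectors_def)

lemma totally_isotropic_radical: "subspace W \<Longrightarrow> totally_isotropic (W \<inter> perp W)"
  using subspace_inter[OF _ subspace_perp] by (auto simp: totally_isotropic_def perp_def)

lemma dim_totally_isotropic_le:
  assumes "totally_isotropic U"
  shows "dim U \<le> d"
  using assms dim_perp[of U] dim_subset[of U "perp U"] by (simp add: totally_isotropic_iff)

text \<open>By \<open>perp_perp\<close>, \<open>W\<close> and \<open>perp W\<close> have the same
  radical.\<close>

lemma card_isotropic_vectors_perp:
  assumes "subspace W" "dim W + n = 2 * d"
  shows "int q * int (card (isotropic_vectors (perp W)))
    = int q ^ (2 * n) + (int q - 1) * (- int q) ^ (n + dim (W \<inter> perp W))"
proof -
  have "dim (perp W) = n"
    using dim_perp[OF assms(1)] assms(2) by simp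
  then show ?thesis
    using card_isotropic_vectors[OF subspace_perp, of W] perp_perp[OF assms(1)] by (simp add: Int_commute)
qed

lemma card_isotropic_vectors_perp_diff:
  assumes "subspace W" "dim W + n = 2 * d" "totally_isotropic U" "U \<subseteq> perp W"
  shows "int q * int (card (isotropic_vectors (perp W) - U))
    = int q ^ (2 * n) + (int q - 1) * (- int q) ^ (n + dim (W \<inter> perp W)) - int q * int q ^ (2 * dim U)"
proof -
  have "card (isotropic_vectors (perp W) - U) = card (isotropic_vectors (perp W)) - card U"
    using subset_isotropic_vectors[OF assms(3,4)] finite_vectors by (intro card_Diff_subset)
  moreover have "card U \<le> card (isotropic_vectors (perp W))"
    using subset_isotropic_vectors[OF assms(3,4)] finite_vectors by (intro card_mono)
  ultimately have "int (card (isotropic_vectors (perp W) - U)) = int (card (isotropic_vectors (perp W))) - int q ^ (2 * dim U)"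
    using card_subspace[of U] assms(3) by (simp add: totally_isotropic_def of_nat_diff)
  then show ?thesis
    using card_isotropic_vectors_perp[OF assms(1,2)] by (simp add: right_diff_distrib)
qed

text \<open>Here the exponent \<open>n + dim U\<close> is \<open>2 * d\<close>, so the signed term
  of the count is positive and \<open>perp U\<close> has more isotropic vectors than
  \<open>U\<close> has vectors.\<close>

lemma exists_isotropic_extension:
  assumes "totally_isotropic U" "dim U < d"
  shows "\<exists>v \<in> isotropic_vectors (perp U). v \<notin> U"
proof (rule ccontr)
  assume "\<not> ?thesis"
  then have empty: "isotropic_vectors (perp U) - U = {}"
    by blast
  have U: "subspace U" "U \<subseteq> perp U" "U \<inter> perp U = U"
    using assms by (auto simp: totally_isotropic_iff)
  define n where "n = 2 * d - dim U"
  have n: "dim U + n = 2 * d" "n \<ge> dim U + 1"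
    using assms unfolding n_def by auto
  have "int q ^ (2 * n) + (int q - 1) * (- int q) ^ (n + dim U) = int q * int q ^ (2 * dim U)"
    using card_isotropic_vectors_perp_diff[OF U(1) n(1) assms(1) U(2)] U(3) empty by simp
  moreover have "(- int q) ^ (n + dim U) = int q ^ (2 * d)"
    using n by (simp add: add.commute)
  moreover have "int q ^ (2 * dim U + 1) \<le> int q ^ (2 * n)"
    using n q_ge_2 by (intro power_increasing) auto
  moreover have "(int q - 1) * int q ^ (2 * d) > 0"
    using q_ge_2 by simp
  ultimately show False
    by simp
qed

lemma dim_span_insert:
  assumes "subspace A" "v \<notin> A"
  shows "dim (span (insert v A)) = dim A + 1"
  using assms by (metis dim_insert dim_span span_eq_iff)

lemma exists_generator:
  assumes "totally_isotropic U"
  shows "\<exists>G \<in> generators. U \<subseteq> G"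
  using assms
proof (induction "d - dim U" arbitrary: U)
  case 0
  then have "U \<in> generators"
    using dim_totally_isotropic_le[of U] by (simp add: generators_def)
  then show ?case
    by blast
next
  case (Suc n)
  then have "dim U < d"
    by simp
  then obtain v where v: "v \<in> isotropic_vectors (perp U)" "v \<notin> U"
    using exists_isotropic_extension[OF Suc.prems] by blast
  have "dim (span (insert v U)) = dim U + 1"
    using v Suc.prems by (intro dim_span_insert) (simp_all add: totally_isotropic_def)
  then have "n = d - dim (span (insert v U))"
    using Suc.hyps(2) by simp
  then obtain G where "G \<in> generators" "span (insert v U) \<subseteq> G"
    using Suc.hyps(1) totally_isotropic_span_insert[OF Suc.prems v(1)] by blast
  then show ?case
    using span_superset[of "insert v U"] by blast
qed

lemma pointE:
  assumes "P \<in> points"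
  obtains p where "p \<noteq> 0" "P = span {p}"
proof -
  have "subspace P" "dim P = 1"
    using assms by (auto simp: points_def totally_isotropic_def)
  then obtain B where B: "independent B" "span B = P" "card B = 1"
    using basis_subspace_exists by metis
  then obtain p where "B = {p}"
    using card_1_singletonE by blast
  with B show thesis
    using that[of p] dependent_zero[of B] by auto
qed

lemma point_subset_iff:
  assumes "P = span {p}" "subspace A"
  shows "P \<subseteq> A \<longleftrightarrow> p \<in> A"
  using assms span_minimal[of "{p}" A] span_base[of p "{p}"] by auto

lemma span_Un_span: "span (A \<union> span B) = span (A \<union> B)"
proof (rule span_subspace)
  show "A \<union> span B \<subseteq> span (A \<union> B)"
    using span_mono[of B "A \<union> B"] span_superset[of "A \<union> B"] by auto
  show "span (A \<union> B) \<subseteq> span (A \<union> span B)"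
    using span_superset[of B] by (intro span_mono) auto
qed simp

lemma dim_span_Un_point:
  assumes "P \<in> points" "subspace A" "\<not> P \<subseteq> A"
  shows "dim (span (A \<union> P)) = dim A + 1"
proof -
  obtain p where p: "p \<noteq> 0" "P = span {p}"
    using pointE[OF assms(1)] .
  then have "p \<notin> A"
    using point_subset_iff[OF p(2) assms(2)] assms(3) by simp
  moreover have "span (A \<union> P) = span (insert p A)"
    using p(2) span_Un_span[of A "{p}"] by simp
  ultimately show ?thesis
    using assms(2) dim_span_insert by metis
qed

lemma totally_isotropic_span_Un:
  assumes "totally_isotropic U" "totally_isotropic P" "P \<subseteq> perp U"
  shows "totally_isotropic (span (U \<union> P))"
  using assms subset_perp_commute[of P U]
  by (intro totally_isotropic_span) (auto simp: perp_Un totally_isotropic_iff)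

end

subsection \<open>Ovoid points orthogonal to a totally isotropic subspace\<close>

locale hermitian_ovoid = hermitian_polar_space scale h q d
  for scale :: "'a::field \<Rightarrow> 'v::ab_group_add \<Rightarrow> 'v" and h q d +
  fixes \<O> :: "'v set set"
  assumes ovoid: "ovoid \<O>"
begin

lemma finite_sets: "finite (X :: 'v set set)"
  using finite_vectors[of UNIV] by (metis Finite_Set.finite_set finite_subset subset_UNIV)

lemma ovoid_point: "P \<in> \<O> \<Longrightarrow> P \<in> points"
  using ovoid by (auto simp: ovoid_def)

lemma ovoid_totally_isotropic: "P \<in> \<O> \<Longrightarrow> totally_isotropic P"
  using ovoid_point by (auto simp: points_def)

text \<open>Orthogonal ovoid points span a totally isotropic subspace; a generator above it contains
  both, and it contains only one ovoid point.\<close>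

lemma ovoid_orthogonal_eq:
  assumes "P \<in> \<O>" "Q \<in> \<O>" "P \<subseteq> perp Q"
  shows "P = Q"
proof -
  have "totally_isotropic (span (Q \<union> P))"
    using assms ovoid_totally_isotropic by (intro totally_isotropic_span_Un)
  then obtain G where "G \<in> generators" "span (Q \<union> P) \<subseteq> G"
    using exists_generator by blast
  then have "P \<subseteq> G" "Q \<subseteq> G" "\<exists>!P. P \<in> \<O> \<and> P \<subseteq> G"
    using span_superset[of "Q \<union> P"] ovoid by (auto simp: ovoid_def)
  then show ?thesis
    using assms by blast
qed

lemma ovoid_meets_generator: "dim U = d \<Longrightarrow> totally_isotropic U \<Longrightarrow> \<exists>P\<in>\<O>. P \<subseteq> U"
  using ovoid unfolding ovoid_def generators_def by blast

text \<open>These points stand for the ovoid inherited by the quotient of \<open>perp U\<close> by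
  \<open>U\<close>; the quotient itself is never formed.\<close>

definition ovoid_perp :: "'v set \<Rightarrow> 'v set set" where
  "ovoid_perp U = {P \<in> \<O>. P \<subseteq> perp U}"

lemma ovoid_perp_span_insert:
  "{P \<in> ovoid_perp U. R \<in> perp P} = ovoid_perp (span (insert R U))"
  using h_eq_0_commute unfolding ovoid_perp_def perp_span by (auto simp: perp_def)

text \<open>Orthogonal pairs \<open>(R, P)\<close>, counted by \<open>R\<close> on the left and by
  \<open>P\<close> on the right.\<close>

lemma double_count:
  "(\<Sum>R\<in>S. card (ovoid_perp (span (insert R U)))) = (\<Sum>P\<in>ovoid_perp U. card {R \<in> S. R \<in> perp P})"
  unfolding ovoid_perp_span_insert[symmetric]
  by (intro sum_multicount_gen finite_vectors finite_sets) simp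

lemma isotropic_vectors_perp_point:
  "{R \<in> isotropic_vectors (perp W) - U. R \<in> perp P} = isotropic_vectors (perp (span (W \<union> P))) - U"
  unfolding perp_span perp_Un isotropic_vectors_def by auto

text \<open>An ovoid point orthogonal to \<open>U\<close> is orthogonal to \<open>P\<close>, hence
  equal to it.\<close>

lemma ovoid_perp_eq_singleton:
  assumes "totally_isotropic U" "P \<in> \<O>" "P \<subseteq> U"
  shows "ovoid_perp U = {P}"
proof
  show "ovoid_perp U \<subseteq> {P}"
  proof
    fix Q assume "Q \<in> ovoid_perp U"
    moreover from this have "Q \<subseteq> perp P"
      using assms(3) by (auto simp: ovoid_perp_def perp_def)
    ultimately show "Q \<in> {P}"
      using assms(2) ovoid_orthogonal_eq[of Q P] by (auto simp: ovoid_perp_def)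
  qed
  show "{P} \<subseteq> ovoid_perp U"
    using assms totally_isotropic_subset_perp[of U P U] by (auto simp: ovoid_perp_def)
qed

text \<open>The vectors in question form the union of the sets
  \<open>span (U \<union> P) - U\<close> over \<open>P\<close> in \<open>ovoid_perp U\<close>. These
  are disjoint: a common vector would put two ovoid points into one totally isotropic
  subspace.\<close>

lemma card_extensions_meeting_ovoid:
  assumes U: "totally_isotropic U" and disj: "\<And>P. P \<in> \<O> \<Longrightarrow> \<not> P \<subseteq> U"
  shows "int (card {R \<in> isotropic_vectors (perp U) - U. \<exists>P\<in>\<O>. P \<subseteq> span (insert R U)})
    = int (card (ovoid_perp U)) * ((int q ^ 2 - 1) * int q ^ (2 * dim U))"
proof -
  let ?S = "{R \<in> isotropic_vectors (perp U) - U. \<exists>P\<in>\<O>. P \<subseteq> span (insert R U)}"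
  let ?C = "\<lambda>P. span (U \<union> P) - U"
  have sub: "subspace U" "span U = U"
    using U by (auto simp: totally_isotropic_def)
  have P: "P \<in> \<O>" "P \<subseteq> perp U" "totally_isotropic (span (U \<union> P))" "dim (span (U \<union> P)) = dim U + 1"
    if "P \<in> ovoid_perp U" for P
    using that totally_isotropic_span_Un[OF U] ovoid_totally_isotropic dim_span_Un_point[of P U]
      disj sub ovoid_point by (auto simp: ovoid_perp_def)
  have dim_R: "dim (span (insert R U)) = dim U + 1" if "R \<notin> U" for R
    using that sub dim_span_insert by blast
  have C: "span (insert R U) = span (U \<union> P)" if "P \<in> ovoid_perp U" "R \<in> ?C P" for P R
  proof (rule subspace_dim_equal)
    show "span (insert R U) \<subseteq> span (U \<union> P)"
      using that span_superset[of "U \<union> P"] by (intro span_minimal) auto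
  qed (use dim_R P that in auto)
  have "?S = (\<Union>P\<in>ovoid_perp U. ?C P)"
  proof (intro equalityI subsetI)
    fix R assume "R \<in> ?S"
    then obtain P where R: "R \<in> isotropic_vectors (perp U)" "R \<notin> U" "P \<in> \<O>" "P \<subseteq> span (insert R U)"
      by blast
    have "totally_isotropic (span (insert R U))"
      using totally_isotropic_span_insert[OF U R(1)] .
    moreover have le: "U \<subseteq> span (insert R U)"
      using span_superset by blast
    ultimately have "P \<subseteq> perp U"
      using R(4) totally_isotropic_subset_perp by blast
    then have mem: "P \<in> ovoid_perp U"
      using R by (simp add: ovoid_perp_def)
    have "span (U \<union> P) = span (insert R U)"
    proof (rule subspace_dim_equal)
      show "span (U \<union> P) \<subseteq> span (insert R U)"
        using le R(4) by (intro span_minimal) auto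
    qed (use dim_R[OF R(2)] P(4)[OF mem] in auto)
    then show "R \<in> (\<Union>P\<in>ovoid_perp U. ?C P)"
      using mem R(2) span_base[of R "insert R U"] by blast
  next
    fix R assume "R \<in> (\<Union>P\<in>ovoid_perp U. ?C P)"
    then obtain P0 where R: "P0 \<in> ovoid_perp U" "R \<in> span (U \<union> P0)" "R \<notin> U"
      by blast
    have "P0 \<subseteq> span (insert R U)" "U \<subseteq> span (U \<union> P0)"
      using C[of P0 R] R span_superset[of "U \<union> P0"] by auto
    moreover have "R \<in> isotropic_vectors (perp U)"
      using P(3)[OF R(1)] R(2) \<open>U \<subseteq> span (U \<union> P0)\<close>
      by (auto simp: totally_isotropic_def isotropic_vectors_def perp_def)
    ultimately show "R \<in> ?S"
      using R P(1) by blast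
  qed
  moreover have "?C P \<inter> ?C Q = {}" if "P \<in> ovoid_perp U" "Q \<in> ovoid_perp U" "P \<noteq> Q" for P Q
  proof (rule ccontr)
    assume "?C P \<inter> ?C Q \<noteq> {}"
    then obtain R where "R \<in> ?C P" "R \<in> ?C Q"
      by blast
    then have "span (U \<union> P) = span (U \<union> Q)"
      using C that by metis
    then have "P \<subseteq> span (U \<union> P)" "Q \<subseteq> span (U \<union> P)"
      using span_superset[of "U \<union> P"] span_superset[of "U \<union> Q"] by auto
    then have "P \<subseteq> perp Q"
      using P(3)[OF that(1)] totally_isotropic_subset_perp by blast
    then show False
      using ovoid_orthogonal_eq P(1) that by blast
  qed
  ultimately have "card ?S = (\<Sum>P\<in>ovoid_perp U. card (?C P))"
    using card_UN_disjoint[OF finite_sets, of "ovoid_perp U" ?C] finite_vectors by auto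
  then have "int (card ?S) = (\<Sum>P\<in>ovoid_perp U. int (card (?C P)))"
    by simp
  also have "\<dots> = (\<Sum>P\<in>ovoid_perp U. (int q ^ 2 - 1) * int q ^ (2 * dim U))"
  proof (rule sum.cong[OF refl])
    fix Q assume Q: "Q \<in> ovoid_perp U"
    have "U \<subseteq> span (U \<union> Q)"
      using span_superset by blast
    then have "card (?C Q) = card (span (U \<union> Q)) - card U" "card U \<le> card (span (U \<union> Q))"
      using finite_vectors by (auto intro: card_Diff_subset card_mono)
    then show "int (card (?C Q)) = (int q ^ 2 - 1) * int q ^ (2 * dim U)"
      using card_subspace(2)[OF sub(1)] card_subspace(2)[OF subspace_span, of "U \<union> Q"] P(4)[OF Q]
      by (simp add: of_nat_diff power2_eq_square algebra_simps del: dim_span)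
  qed
  finally show ?thesis
    by simp
qed

text \<open>Induction on \<open>d - dim U\<close>, double counting orthogonal pairs of an isotropic
  vector \<open>R\<close> in \<open>perp U - U\<close> and an ovoid point. If
  \<open>span (insert R U)\<close> contains an ovoid point, that is the only one orthogonal to it;
  otherwise the induction hypothesis applies. The result is a linear equation for the unknown
  number.\<close>

lemma card_ovoid_perp:
  assumes "totally_isotropic U" "\<And>P. P \<in> \<O> \<Longrightarrow> \<not> P \<subseteq> U"
  shows "int q * int (card (ovoid_perp U)) = int q ^ (2 * (d - dim U)) + int q"
  using assms
proof (induction "d - dim U" arbitrary: U)
  case 0
  \<comment> \<open>A generator contains an ovoid point, so the base case is vacuous.\<close>
  then have "dim U = d"
    using dim_totally_isotropic_le[of U] by simp
  then show ?case
    using ovoid_meets_generator 0 by blast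
next
  case (Suc j)
  note U = Suc.prems(1) and disj = Suc.prems(2)
  have sub: "subspace U" "span U = U" "U \<subseteq> perp U" "U \<inter> perp U = U"
    using U by (auto simp: totally_isotropic_iff)
  define k where "k = dim U"
  have d: "d = k + Suc j"
    using Suc.hyps(2) by (simp add: k_def)
  \<comment> \<open>\<open>a\<close> is the number of vectors of \<open>U\<close>; the induction
    hypothesis predicts \<open>D + q\<close> for \<open>q\<close> times the number of points at an
    extension of \<open>U\<close>.\<close>
  define a D where "a = int q ^ (2 * k)" and "D = int q ^ (2 * j)"
  define S where "S = isotropic_vectors (perp U) - U"
  define S1 where "S1 = {R \<in> S. \<exists>P\<in>\<O>. P \<subseteq> span (insert R U)}"
  define T X where "T = int (card S)" and "X = int (card (ovoid_perp U))"
  have n: "dim U + (k + 2 * j + 2) = 2 * d"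
    using d by (simp add: k_def)
  have "int q * int (card S) = int q ^ (2 * (k + 2 * j + 2)) + (int q - 1) * (- int q) ^ (k + 2 * j + 2 + k) - int q * int q ^ (2 * k)"
    using card_isotropic_vectors_perp_diff[OF sub(1) n U sub(3), unfolded sub(4)] by (simp only: S_def k_def)
  also have "(- int q) ^ (k + 2 * j + 2 + k) = a * D * int q ^ 2"
    by (simp add: power_add power_mult power2_eq_square a_def D_def flip: mult_2)
  also have "2 * (k + 2 * j + 2) = 2 * k + 2 * j * 2 + 4"
    by simp
  also have "int q ^ \<dots> = a * D ^ 2 * int q ^ 4"
    by (simp only: a_def D_def power_add power_mult)
  finally have qT: "int q * T = a * (D ^ 2 * int q ^ 4 + (int q - 1) * D * int q ^ 2 - int q)"
    unfolding T_def a_def by (simp add: algebra_simps)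
  have S1: "int (card S1) = X * ((int q ^ 2 - 1) * a)"
    using card_extensions_meeting_ovoid[OF U disj] by (simp add: S1_def S_def X_def a_def k_def)
  have "int q * int (\<Sum>R\<in>S. card (ovoid_perp (span (insert R U)))) = (\<Sum>R\<in>S. int q * int (card (ovoid_perp (span (insert R U)))))"
    by (simp add: sum_distrib_left)
  also have "\<dots> = (\<Sum>R\<in>S1. int q * int (card (ovoid_perp (span (insert R U))))) + (\<Sum>R\<in>S - S1. int q * int (card (ovoid_perp (span (insert R U)))))"
    by (subst sum.subset_diff[of S1]) (auto simp: S1_def finite_vectors)
  also have "(\<Sum>R\<in>S1. int q * int (card (ovoid_perp (span (insert R U))))) = (\<Sum>R\<in>S1. int q)"
  proof (rule sum.cong[OF refl])
    fix R assume "R \<in> S1"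
    then obtain P where P: "R \<in> isotropic_vectors (perp U)" "P \<in> \<O>" "P \<subseteq> span (insert R U)"
      by (auto simp: S1_def S_def)
    then show "int q * int (card (ovoid_perp (span (insert R U)))) = int q"
      using ovoid_perp_eq_singleton[OF totally_isotropic_span_insert[OF U P(1)] P(2,3)] by simp
  qed
  also have "(\<Sum>R\<in>S - S1. int q * int (card (ovoid_perp (span (insert R U))))) = (\<Sum>R\<in>S - S1. D + int q)"
  proof (rule sum.cong[OF refl])
    fix R assume R: "R \<in> S - S1"
    then have R': "R \<in> isotropic_vectors (perp U)" "R \<notin> U" "\<And>P. P \<in> \<O> \<Longrightarrow> \<not> P \<subseteq> span (insert R U)"
      by (auto simp: S1_def S_def)
    have "j = d - dim (span (insert R U))"
      using d R' dim_span_insert[OF sub(1)] by (simp add: k_def)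
    then show "int q * int (card (ovoid_perp (span (insert R U)))) = D + int q"
      using Suc.hyps(1)[OF _ totally_isotropic_span_insert[OF U R'(1)] R'(3)] by (simp add: D_def)
  qed
  also have "(\<Sum>R\<in>S1. int q) + (\<Sum>R\<in>S - S1. D + int q) = int (card S1) * int q + (T - int (card S1)) * (D + int q)"
  proof -
    have "S1 \<subseteq> S"
      by (auto simp: S1_def)
    then have "card (S - S1) = card S - card S1" "card S1 \<le> card S"
      using finite_vectors by (auto intro: card_Diff_subset card_mono)
    then show ?thesis
      by (simp add: T_def of_nat_diff)
  qed
  finally have count1: "int q * int (\<Sum>R\<in>S. card (ovoid_perp (span (insert R U))))
    = int (card S1) * int q + (T - int (card S1)) * (D + int q)" .
  have "int q * int (\<Sum>P\<in>ovoid_perp U. card {R \<in> S. R \<in> perp P}) = (\<Sum>P\<in>ovoid_perp U. int q * int (card {R \<in> S. R \<in> perp P}))"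
    by (simp add: sum_distrib_left)
  also have "\<dots> = (\<Sum>P\<in>ovoid_perp U. a * (D ^ 2 * int q ^ 2 + (int q - 1) * D * int q ^ 2 - int q))"
  proof (rule sum.cong[OF refl])
    fix P assume "P \<in> ovoid_perp U"
    then have P: "P \<in> \<O>" "P \<subseteq> perp U"
      by (auto simp: ovoid_perp_def)
    have ti: "totally_isotropic (span (U \<union> P))"
      using P ovoid_totally_isotropic U by (intro totally_isotropic_span_Un)
    then have rad: "span (U \<union> P) \<inter> perp (span (U \<union> P)) = span (U \<union> P)" "U \<subseteq> perp (span (U \<union> P))"
      using span_superset[of "U \<union> P"] by (auto simp: totally_isotropic_iff)
    have dim: "dim (span (U \<union> P)) = k + 1"
      using dim_span_Un_point[of P U] P ovoid_point disj sub by (simp add: k_def)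
    then have n': "dim (span (U \<union> P)) + (k + 2 * j + 1) = 2 * d"
      using d by simp
    have "int q * int (card (isotropic_vectors (perp (span (U \<union> P))) - U))
      = int q ^ (2 * (k + 2 * j + 1)) + (int q - 1) * (- int q) ^ (k + 2 * j + 1 + (k + 1)) - int q * int q ^ (2 * k)"
      using card_isotropic_vectors_perp_diff[OF subspace_span n' U rad(2), unfolded rad(1) dim] by (simp only: k_def)
    also have "(- int q) ^ (k + 2 * j + 1 + (k + 1)) = a * D * int q ^ 2"
      by (simp add: power_add power_mult power2_eq_square a_def D_def flip: mult_2)
    also have "2 * (k + 2 * j + 1) = 2 * k + 2 * j * 2 + 2"
      by simp
    also have "int q ^ \<dots> = a * D ^ 2 * int q ^ 2"
      by (simp only: a_def D_def power_add power_mult)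
    finally show "int q * int (card {R \<in> S. R \<in> perp P}) = a * (D ^ 2 * int q ^ 2 + (int q - 1) * D * int q ^ 2 - int q)"
      unfolding S_def isotropic_vectors_perp_point a_def by (simp add: algebra_simps)
  qed
  also have "\<dots> = X * (a * (D ^ 2 * int q ^ 2 + (int q - 1) * D * int q ^ 2 - int q))"
    by (simp add: X_def)
  finally have "int (card S1) * int q + (T - int (card S1)) * (D + int q) = X * (a * (D ^ 2 * int q ^ 2 + (int q - 1) * D * int q ^ 2 - int q))"
    using count1 double_count[of U S] by simp
  then have "int q * T * (D + int q) = int q * X * (a * (D ^ 2 * int q ^ 2 + (int q - 1) * D * int q ^ 2 - int q) + (int q ^ 2 - 1) * a * D)"
    unfolding S1 by algebra
  \<comment> \<open>Both sides factor: \<open>q * T\<close> is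
    \<open>a * (D * q ^ 2 - 1) * (D * q ^ 2 + q)\<close>, and the coefficient of
    \<open>q * X\<close> is \<open>a * (D * q ^ 2 - 1) * (D + q)\<close>.\<close>
  then have "(a * ((D + int q) * (D * int q ^ 2 - 1))) * (int q * X) = (a * ((D + int q) * (D * int q ^ 2 - 1))) * (D * int q ^ 2 + int q)"
    unfolding qT by algebra
  moreover have "a * ((D + int q) * (D * int q ^ 2 - 1)) \<noteq> 0"
  proof -
    have "a > 0" "D > 0"
      using q_ge_2 by (auto simp: a_def D_def)
    moreover have "D * int q ^ 2 > 1"
    proof -
      have "D * int q ^ 2 = int q ^ (2 * j + 2)"
        by (simp only: D_def power_add)
      then show ?thesis
        using q_ge_2 one_less_power[of "int q" "2 * j + 2"] by simp
    qed
    ultimately show ?thesis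
      by auto
  qed
  ultimately have "int q * X = D * int q ^ 2 + int q"
    using mult_cancel_left by blast
  moreover have "int q ^ (2 * (d - dim U)) = D * int q ^ 2"
    using d by (simp add: D_def k_def power2_eq_square)
  ultimately show ?case
    by (simp add: X_def)
qed

subsection \<open>Extending a subspace by ovoid points\<close>

definition ovoid_in :: "'v set \<Rightarrow> 'v set set" where
  "ovoid_in W = {P \<in> \<O>. P \<subseteq> W}"

definition degenerate_extensions :: "'v set \<Rightarrow> 'v set set" where
  "degenerate_extensions W = {P \<in> ovoid_perp (W \<inter> perp W). \<not> P \<subseteq> W
    \<and> dim (span (W \<union> P) \<inter> perp (span (W \<union> P))) = dim (W \<inter> perp W) + 1}"

text \<open>The old radical is orthogonal to \<open>P\<close>, so it stays in the radical.
  Conversely the new radical meets \<open>W\<close> inside the old one, and \<open>W\<close> is a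
  hyperplane of \<open>W'\<close>, so at most one dimension is gained.\<close>

lemma radical_extension:
  assumes "subspace W" "P \<in> ovoid_perp (W \<inter> perp W)" "\<not> P \<subseteq> W"
  defines "W' \<equiv> span (W \<union> P)"
  shows "W \<inter> perp W \<subseteq> perp W'"
    and "dim (W' \<inter> perp W') = dim (W \<inter> perp W) \<or> dim (W' \<inter> perp W') = dim (W \<inter> perp W) + 1"
proof -
  have "W \<inter> perp W \<subseteq> perp P"
    using assms(2) subset_perp_commute by (auto simp: ovoid_perp_def)
  then show sub: "W \<inter> perp W \<subseteq> perp W'"
    unfolding W'_def perp_span perp_Un by blast
  have W: "W \<subseteq> W'"
    using span_superset unfolding W'_def by blast
  have dim: "dim W' = dim W + 1"
    unfolding W'_def using assms ovoid_point by (intro dim_span_Un_point) (auto simp: ovoid_perp_def)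
  have "W' \<inter> perp W' \<inter> W \<subseteq> W \<inter> perp W"
    using W by (auto simp: perp_def)
  then have le: "dim (W' \<inter> perp W' \<inter> W) \<le> dim (W \<inter> perp W)"
    by (rule dim_subset)
  have W': "subspace W'"
    by (simp add: W'_def)
  have "dim (W' \<inter> perp W') + dim W \<le> dim (W' \<inter> perp W' \<inter> W) + dim W'"
    using assms W W' subspace_inter[OF W' subspace_perp] by (intro dim_le_dim_Int) auto
  moreover have "dim (W \<inter> perp W) \<le> dim (W' \<inter> perp W')"
    using sub W by (intro dim_subset) auto
  ultimately show "dim (W' \<inter> perp W') = dim (W \<inter> perp W) \<or> dim (W' \<inter> perp W') = dim (W \<inter> perp W) + 1"
    using dim le by linarith
qed

text \<open>Such a point would equal both given points. Hence no totally isotropic subspace of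
  \<open>perp W\<close> contains an ovoid point, and \<open>card_ovoid_perp\<close> applies to all
  of them.\<close>

lemma ovoid_disjoint_perp:
  assumes "subspace W" "P\<^sub>0 \<in> ovoid_in W" "P\<^sub>1 \<in> ovoid_in W" "P\<^sub>0 \<noteq> P\<^sub>1" "P \<in> \<O>"
  shows "\<not> P \<subseteq> perp W"
proof
  assume "P \<subseteq> perp W"
  then have "P \<subseteq> perp P\<^sub>0" "P \<subseteq> perp P\<^sub>1"
    using assms by (auto simp: ovoid_in_def perp_def)
  then show False
    using assms ovoid_orthogonal_eq unfolding ovoid_in_def by blast
qed

lemma ovoid_in_subset: "ovoid_in W \<subseteq> ovoid_perp (W \<inter> perp W)"
  unfolding ovoid_in_def ovoid_perp_def perp_def using h_eq_0_commute by blast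

text \<open>
  Double counting of the pairs \<open>(R, P)\<close> with \<open>R\<close> an isotropic vector of \<open>W\<^sup>\<bottom>\<close> outside the radical of \<open>W\<close> and
  \<open>P\<close> a point of the ovoid orthogonal to \<open>R\<close> and to that radical, both sides multiplied by \<open>q\<^sup>2\<close>. On the right
  the three summands belong to the \<open>P\<close> in \<open>W\<close>, to those that enlarge the radical, and to the others.
\<close>

lemma count_extensions:
  assumes W: "subspace W" and P: "P\<^sub>0 \<in> ovoid_in W" "P\<^sub>1 \<in> ovoid_in W" "P\<^sub>0 \<noteq> P\<^sub>1"
    and dims: "dim (W \<inter> perp W) = k" "dim W + Suc n = 2 * d" "d = k + Suc j"
  defines "a \<equiv> int q ^ (2 * k)" and "D \<equiv> int q ^ (2 * j)" and "N \<equiv> int q ^ (2 * n)" and "s \<equiv> (- int q) ^ (n + k)"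
    and "t \<equiv> int (card (ovoid_in W))" and "e \<equiv> int (card (degenerate_extensions W))"
    and "X \<equiv> int (card (ovoid_perp (W \<inter> perp W)))"
  shows "int q * X = D * int q ^ 2 + int q"
    and "(int q ^ 2 * N - int q * (int q - 1) * s - int q * a) * (D + int q)
      = int q * (t * (int q ^ 2 * N - int q * (int q - 1) * s - int q * a)
          + e * (N - int q * (int q - 1) * s - int q * a)
          + (X - t - e) * (N + (int q - 1) * s - int q * a))"
proof -
  define U where "U = W \<inter> perp W"
  have U: "totally_isotropic U" "subspace U"
    using totally_isotropic_radical[OF W] by (auto simp: U_def totally_isotropic_def)
  have UW: "U \<subseteq> perp W"
    by (simp add: U_def)
  have disj: "\<not> P \<subseteq> perp W" if "P \<in> \<O>" for P
    using ovoid_disjoint_perp[OF W P that] .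
  show "int q * X = D * int q ^ 2 + int q"
    using card_ovoid_perp[of "W \<inter> perp W"] totally_isotropic_radical[OF W] disj dims
    by (simp add: X_def D_def power_add power2_eq_square)
  define S where "S = isotropic_vectors (perp W) - U"
  define T where "T = int (card S)"
  have qT: "int q * T = int q ^ 2 * N - int q * (int q - 1) * s - int q * a"
    using card_isotropic_vectors_perp_diff[OF W dims(2) U(1) UW] dims(1)
    by (simp add: T_def S_def U_def N_def s_def a_def power_add power2_eq_square algebra_simps)
  have "int q * int (\<Sum>R\<in>S. card (ovoid_perp (span (insert R U)))) = (\<Sum>R\<in>S. int q * int (card (ovoid_perp (span (insert R U)))))"
    by (simp add: sum_distrib_left)
  also have "\<dots> = (\<Sum>R\<in>S. D + int q)"
  proof (rule sum.cong[OF refl])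
    fix R assume "R \<in> S"
    then have R: "R \<in> perp W" "R \<in> isotropic_vectors (perp U)" "R \<notin> U"
      by (auto simp: S_def isotropic_vectors_def U_def perp_def)
    \<comment> \<open>Staying inside \<open>perp W\<close> rules out extensions that contain an
      ovoid point, so every \<open>R\<close> contributes the same amount.\<close>
    have "span (insert R U) \<subseteq> perp W"
      using R UW subspace_perp by (intro span_minimal) auto
    then have "\<not> P \<subseteq> span (insert R U)" if "P \<in> \<O>" for P
      using disj that by blast
    moreover have "dim (span (insert R U)) = k + 1"
      using dim_span_insert[OF U(2) R(3)] dims(1) by (simp add: U_def)
    ultimately show "int q * int (card (ovoid_perp (span (insert R U)))) = D + int q"
      using card_ovoid_perp[OF totally_isotropic_span_insert[OF U(1) R(2)]] dims(3) by (simp add: D_def)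
  qed
  finally have count1: "int q * int (\<Sum>R\<in>S. card (ovoid_perp (span (insert R U)))) = T * (D + int q)"
    by (simp add: T_def)
  let ?f = "\<lambda>P. int q * int (card {R \<in> S. R \<in> perp P})"
  have f: "?f P = int q ^ (2 * n) + (int q - 1) * (- int q) ^ (n + dim (span (W \<union> P) \<inter> perp (span (W \<union> P)))) - int q * a"
    if "P \<in> ovoid_perp U" "\<not> P \<subseteq> W" for P
  proof -
    have "dim (span (W \<union> P)) + n = 2 * d"
      using dim_span_Un_point[OF _ W, of P] that ovoid_point dims(2) by (auto simp: ovoid_perp_def)
    moreover have "U \<subseteq> perp (span (W \<union> P))"
      using radical_extension(1)[OF W, of P] that by (simp add: U_def)
    ultimately show ?thesis
      unfolding S_def isotropic_vectors_perp_point
      using card_isotropic_vectors_perp_diff[OF subspace_span _ U(1), of "W \<union> P" n] dims(1)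
      by (simp add: a_def U_def)
  qed
  have in_W: "?f P = int q ^ 2 * N - int q * (int q - 1) * s - int q * a" if "P \<in> ovoid_in W" for P
  proof -
    have "{R \<in> S. R \<in> perp P} = S"
      using that by (auto simp: S_def isotropic_vectors_def ovoid_in_def perp_def)
    then show ?thesis
      using qT by (simp add: T_def)
  qed
  \<comment> \<open>One more dimension in the radical multiplies the signed term by
    \<open>- q\<close>; this separates the degenerate points from the others.\<close>
  have deg: "?f P = N - int q * (int q - 1) * s - int q * a" if "P \<in> degenerate_extensions W" for P
    using f[of P] that dims(1)
    by (simp add: degenerate_extensions_def U_def N_def s_def algebra_simps)
  have nondeg: "?f P = N + (int q - 1) * s - int q * a"
    if "P \<in> ovoid_perp U - ovoid_in W - degenerate_extensions W" for P
  proof -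
    have *: "P \<in> ovoid_perp (W \<inter> perp W)" "\<not> P \<subseteq> W"
      using that by (auto simp: U_def ovoid_in_def ovoid_perp_def)
    then have "dim (span (W \<union> P) \<inter> perp (span (W \<union> P))) = k"
      using radical_extension(2)[OF W *] that dims(1) by (auto simp: degenerate_extensions_def)
    then show ?thesis
      using f[of P] * by (simp add: U_def N_def s_def)
  qed
  have sub: "ovoid_in W \<subseteq> ovoid_perp U" "degenerate_extensions W \<subseteq> ovoid_perp U"
    "ovoid_in W \<inter> degenerate_extensions W = {}"
    using ovoid_in_subset by (auto simp: U_def degenerate_extensions_def ovoid_in_def)
  have "int q * int (\<Sum>P\<in>ovoid_perp U. card {R \<in> S. R \<in> perp P}) = (\<Sum>P\<in>ovoid_perp U. ?f P)"
    by (simp add: sum_distrib_left)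
  also have "\<dots> = (\<Sum>P\<in>ovoid_in W. ?f P) + (\<Sum>P\<in>degenerate_extensions W. ?f P)
      + (\<Sum>P\<in>ovoid_perp U - ovoid_in W - degenerate_extensions W. ?f P)"
    by (rule sum_card_Diff_Diff(1)[OF sub finite_sets])
  also have "\<dots> = t * (int q ^ 2 * N - int q * (int q - 1) * s - int q * a)
          + e * (N - int q * (int q - 1) * s - int q * a)
          + (X - t - e) * (N + (int q - 1) * s - int q * a)"
    using in_W deg nondeg sum_card_Diff_Diff(2)[OF sub finite_sets]
    by (simp add: t_def e_def X_def U_def)
  finally have "T * (D + int q) = t * (int q ^ 2 * N - int q * (int q - 1) * s - int q * a)
          + e * (N - int q * (int q - 1) * s - int q * a)
          + (X - t - e) * (N + (int q - 1) * s - int q * a)"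
    using count1 double_count[of U S] by simp
  then show "(int q ^ 2 * N - int q * (int q - 1) * s - int q * a) * (D + int q)
      = int q * (t * (int q ^ 2 * N - int q * (int q - 1) * s - int q * a)
          + e * (N - int q * (int q - 1) * s - int q * a)
          + (X - t - e) * (N + (int q - 1) * s - int q * a))"
    unfolding qT[symmetric] by algebra
qed

text \<open>\<open>count_extensions\<close> is linear in \<open>e\<close>. Degenerate and other
  points contribute amounts differing by \<open>(q ^ 2 - 1) * s\<close> up to sign, where
  \<open>s = a * E\<close> here, so the equation can be solved for \<open>e\<close>.\<close>

lemma card_degenerate_extensions_plane:
  assumes W: "subspace W" and P: "P\<^sub>0 \<in> ovoid_in W" "P\<^sub>1 \<in> ovoid_in W" "P\<^sub>0 \<noteq> P\<^sub>1"
    and dims: "dim (W \<inter> perp W) = k" "dim W = k + 3" "k + 3 \<le> d"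
  defines "E \<equiv> int q ^ (2 * (d - k - 2))"
  shows "int (card (ovoid_perp (W \<inter> perp W))) = int q ^ 3 * E + 1"
    and "int (card (degenerate_extensions W)) = (E - 1) * (int (card (ovoid_in W)) + int q ^ 2 - 1)"
proof -
  define i where "i = d - k - 2"
  define t e X where "t = int (card (ovoid_in W))" and "e = int (card (degenerate_extensions W))"
    and "X = int (card (ovoid_perp (W \<inter> perp W)))"
  define a where "a = int q ^ (2 * k)"
  have d: "d = k + Suc (i + 1)" "dim W + Suc (k + 2 * i) = 2 * d" and E: "E = int q ^ (2 * i)"
    using dims by (auto simp: i_def E_def)
  have D: "int q ^ (2 * (i + 1)) = int q ^ 2 * E" and N: "int q ^ (2 * (k + 2 * i)) = a * E ^ 2"
    by (simp_all add: E a_def flip: power_add power_mult)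
  have s: "(- int q) ^ (k + 2 * i + k) = a * E"
    by (simp add: E a_def power_add power_mult power2_eq_square flip: mult_2)
  note count = count_extensions[OF W P dims(1) d(2,1), folded t_def e_def X_def a_def, unfolded D N s]
  have pos: "int q > 0" "a > 0" "E > 0" "int q ^ 2 > 1"
    using q_ge_2 one_less_power[of "int q" 2] by (auto simp: a_def E)
  have "int q * X = int q * (int q ^ 3 * E + 1)"
    using count(1) by algebra
  then show X: "X = int q ^ 3 * E + 1"
    using pos by (metis less_irrefl mult_cancel_left)
  have "(int q * a * (int q ^ 2 - 1) * E) * e = (int q * a * (int q ^ 2 - 1) * E) * ((E - 1) * (t + int q ^ 2 - 1))"
    using count(2) unfolding X by algebra
  moreover have "int q * a * (int q ^ 2 - 1) * E \<noteq> 0"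
    using pos by auto
  ultimately show "e = (E - 1) * (t + int q ^ 2 - 1)"
    using mult_cancel_left by blast
qed

text \<open>The same computation with one dimension less, where \<open>s\<close> is negative. It
  serves to find the initial nondegenerate plane.\<close>

lemma card_degenerate_extensions_line:
  assumes W: "subspace W" and P: "P\<^sub>0 \<in> ovoid_in W" "P\<^sub>1 \<in> ovoid_in W" "P\<^sub>0 \<noteq> P\<^sub>1"
    and dims: "dim (W \<inter> perp W) = k" "dim W = k + 2" "k + 2 \<le> d"
  defines "E \<equiv> int q ^ (2 * (d - k - 2))"
  shows "int (card (ovoid_perp (W \<inter> perp W))) = int q ^ 3 * E + 1"
    and "int (card (degenerate_extensions W)) = (int q * E + 1) * (int q + 1 - int (card (ovoid_in W)))"
proof -
  define i where "i = d - k - 2"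
  define t e X where "t = int (card (ovoid_in W))" and "e = int (card (degenerate_extensions W))"
    and "X = int (card (ovoid_perp (W \<inter> perp W)))"
  define a where "a = int q ^ (2 * k)"
  have d: "d = k + Suc (i + 1)" "dim W + Suc (k + 2 * i + 1) = 2 * d" and E: "E = int q ^ (2 * i)"
    using dims by (auto simp: i_def E_def)
  have D: "int q ^ (2 * (i + 1)) = int q ^ 2 * E" and N: "int q ^ (2 * (k + 2 * i + 1)) = a * int q ^ 2 * E ^ 2"
    by (simp_all add: E a_def flip: power_add power_mult)
  have s: "(- int q) ^ (k + 2 * i + 1 + k) = - (int q * a * E)"
    by (simp add: E a_def power_add power_mult power2_eq_square flip: mult_2)
  note count = count_extensions[OF W P dims(1) d(2,1), folded t_def e_def X_def a_def, unfolded D N s]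
  have pos: "int q > 0" "a > 0" "E > 0" "int q ^ 2 > 1"
    using q_ge_2 one_less_power[of "int q" 2] by (auto simp: a_def E)
  have "int q * X = int q * (int q ^ 3 * E + 1)"
    using count(1) by algebra
  then show X: "X = int q ^ 3 * E + 1"
    using pos by (metis less_irrefl mult_cancel_left)
  have "(int q * a * (int q ^ 2 - 1) * int q * E) * e = (int q * a * (int q ^ 2 - 1) * int q * E) * ((int q * E + 1) * (int q + 1 - t))"
    using count(2) unfolding X by algebra
  moreover have "int q * a * (int q ^ 2 - 1) * int q * E \<noteq> 0"
    using pos by auto
  ultimately show "e = (int q * E + 1) * (int q + 1 - t)"
    using mult_cancel_left by blast
qed

section \<open>The initial plane, its iterated extension and the final bound\<close>

lemma exists_two_points:
  assumes "2 \<le> card (A :: 'v set set)"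
  obtains P Q where "P \<in> A" "Q \<in> A" "P \<noteq> Q"
  using assms card_le_Suc0_iff_eq[OF finite_sets, of A] by auto

lemma extension_by_ovoid_point:
  assumes "subspace W" "P \<in> \<O>" "\<not> P \<subseteq> W"
  shows "dim (span (W \<union> P)) = dim W + 1"
    and "card (ovoid_in (span (W \<union> P))) \<ge> card (ovoid_in W) + 1"
proof -
  show "dim (span (W \<union> P)) = dim W + 1"
    using assms ovoid_point by (intro dim_span_Un_point)
  have "insert P (ovoid_in W) \<subseteq> ovoid_in (span (W \<union> P))"
    using assms(2) span_superset[of "W \<union> P"] by (auto simp: ovoid_in_def)
  then have "card (insert P (ovoid_in W)) \<le> card (ovoid_in (span (W \<union> P)))"
    by (rule card_mono[OF finite_sets])
  then show "card (ovoid_in (span (W \<union> P))) \<ge> card (ovoid_in W) + 1"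
    using assms(3) finite_sets[of "ovoid_in W"] by (simp add: ovoid_in_def)
qed

text \<open>\<open>card_ovoid_perp\<close> for the zero subspace gives the size of the whole
  ovoid.\<close>

lemma exists_two_ovoid_points: "\<exists>P\<in>\<O>. \<exists>Q\<in>\<O>. P \<noteq> Q"
proof -
  have "\<not> P \<subseteq> {0}" if "P \<in> \<O>" for P
    using ovoid_point[OF that] by (auto simp: points_def simp flip: dim_eq_0)
  then have "int q * int (card (ovoid_perp {0})) = int q ^ (2 * d) + int q"
    using card_ovoid_perp[of "{0}"] by (simp add: totally_isotropic_def h_zero)
  moreover have "int q ^ (2 * d) \<ge> int q ^ 1"
    using q_ge_2 d_pos by (intro power_increasing) auto
  ultimately have "int q * 2 \<le> int q * int (card (ovoid_perp {0}))"
    by simp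
  then have "2 \<le> card (ovoid_perp {0})"
    using q_ge_2 by (simp add: mult_le_cancel_left)
  then obtain P Q where "P \<in> ovoid_perp {0}" "Q \<in> ovoid_perp {0}" "P \<noteq> Q"
    using exists_two_points by blast
  then show ?thesis
    unfolding ovoid_perp_def by blast
qed

text \<open>Distinct ovoid points are not orthogonal. Pairing a combination of their isotropic
  spanning vectors with each of these vectors reads off both coefficients.\<close>

lemma hyperbolic_line:
  assumes "P \<in> \<O>" "Q \<in> \<O>" "P \<noteq> Q"
  defines "L \<equiv> span (P \<union> Q)"
  shows "dim (L \<inter> perp L) = 0" "dim L = 2"
proof -
  obtain p r where pr: "P = span {p}" "Q = span {r}"
    using assms ovoid_point pointE by metis
  have "\<not> Q \<subseteq> P"
    using assms ovoid_orthogonal_eq[of Q P] ovoid_totally_isotropic[of P] by (auto simp: totally_isotropic_iff)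
  then show "dim L = 2"
    unfolding L_def using assms ovoid_point extension_by_ovoid_point(1)[of P Q] by (auto simp: points_def totally_isotropic_def)
  have "\<not> P \<subseteq> perp Q"
    using assms ovoid_orthogonal_eq by blast
  then have nz: "h p r \<noteq> 0" "h r p \<noteq> 0"
    using point_subset_iff[OF pr(1) subspace_perp] h_eq_0_commute[of r p] unfolding pr(2) perp_span by (auto simp: perp_def)
  have iso: "h p p = 0" "h r r = 0"
    using assms(1,2) ovoid_totally_isotropic pr span_base by (auto simp: totally_isotropic_def)
  have L: "L = span {p, r}"
    unfolding L_def pr using span_Un_span[of "{r}" "{p}"] span_Un_span[of "span {p}" "{r}"]
    by (simp add: insert_commute Un_commute)
  have "x = 0" if x: "x \<in> L \<inter> perp L" for x
  proof -
    obtain k where "x - scale k p \<in> span {r}"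
      using x span_breakdown_eq[of x p "{r}"] unfolding L by auto
    then obtain l where "x - scale k p = scale l r"
      by (auto simp: span_singleton)
    then have x_eq: "x = scale k p + scale l r"
      by (metis add.commute diff_add_cancel)
    have "p \<in> L" "r \<in> L"
      unfolding L by (auto intro: span_base)
    then have "h x p = 0" "h x r = 0"
      using x by (auto simp: perp_def)
    then show "x = 0"
      using nz iso unfolding x_eq by (auto simp: h_add h_scale)
  qed
  then show "dim (L \<inter> perp L) = 0"
    by auto
qed

text \<open>On the line \<open>L\<close> through two ovoid points, the points in \<open>L\<close>
  and the degenerate extensions do not exhaust the ovoid. Any remaining point spans with
  \<open>L\<close> a plane whose radical is still zero.\<close>

lemma exists_nondegenerate_plane:
  assumes "d \<ge> 2"
  shows "\<exists>W. subspace W \<and> dim (W \<inter> perp W) = 0 \<and> dim W = 3 \<and> card (ovoid_in W) \<ge> 3"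
proof -
  obtain P Q where PQ: "P \<in> \<O>" "Q \<in> \<O>" "P \<noteq> Q"
    using exists_two_ovoid_points by blast
  define L where "L = span (P \<union> Q)"
  have L: "subspace L" "dim (L \<inter> perp L) = 0" "dim L = 0 + 2"
    using hyperbolic_line[OF PQ] by (simp_all add: L_def)
  have mem: "P \<in> ovoid_in L" "Q \<in> ovoid_in L"
    using PQ span_superset[of "P \<union> Q"] by (auto simp: ovoid_in_def L_def)
  then have t2: "card (ovoid_in L) \<ge> 2"
    using card_mono[OF finite_sets, of "{P, Q}" "ovoid_in L"] PQ(3) by simp
  define E where "E = int q ^ (2 * (d - 0 - 2))"
  define t where "t = int (card (ovoid_in L))"
  note count = card_degenerate_extensions_line[OF L(1) mem PQ(3) L(2,3), folded E_def t_def]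
  have E: "E \<ge> 1" and q: "int q \<ge> 2"
    using q_ge_2 by (auto simp: E_def)
  have e: "int (card (degenerate_extensions L)) = (int q * E + 1) * (int q + 1 - t)"
    using count assms by simp
  have t: "t \<ge> 2"
    using t2 by (simp add: t_def)
  have "int q * E + 1 > 0"
    using E q by (simp add: add_nonneg_pos)
  moreover have "(int q * E + 1) * (int q + 1 - t) \<ge> 0"
    using e by simp
  \<comment> \<open>The second factor cannot be negative, since the product counts points.\<close>
  ultimately have t_le: "t \<le> int q + 1"
    unfolding zero_le_mult_iff by linarith
  have "(int q * E + 1) * (int q + 1 - t) \<le> (int q * E + 1) * (int q - 1)"
    using t \<open>int q * E + 1 > 0\<close> by (intro mult_left_mono) auto
  moreover have "int q ^ 3 * E + 1 - (int q + 1) - (int q * E + 1) * (int q - 1) > 0"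
  proof -
    have "int q ^ 3 * E + 1 - (int q + 1) - (int q * E + 1) * (int q - 1) = int q * (E * (int q * (int q - 1) + 1) - 2) + 1"
      by (simp add: algebra_simps power3_eq_cube)
    moreover have "int q * (int q - 1) \<ge> 1 * 1"
      using q by (intro mult_mono) auto
    then have "E * (int q * (int q - 1) + 1) \<ge> 1 * 2"
      using E by (intro mult_mono) auto
    then have "int q * (E * (int q * (int q - 1) + 1) - 2) \<ge> 0"
      using q by simp
    ultimately show ?thesis
      by linarith
  qed
  ultimately have less: "int (card (ovoid_in L)) + int (card (degenerate_extensions L)) < int (card (ovoid_perp (L \<inter> perp L)))"
    using e t_le count(1) assms by (simp add: t_def)
  have "\<not> ovoid_perp (L \<inter> perp L) \<subseteq> ovoid_in L \<union> degenerate_extensions L"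
  proof
    assume "ovoid_perp (L \<inter> perp L) \<subseteq> ovoid_in L \<union> degenerate_extensions L"
    then have "card (ovoid_perp (L \<inter> perp L)) \<le> card (ovoid_in L \<union> degenerate_extensions L)"
      by (rule card_mono[OF finite_sets])
    then show False
      using less card_Un_le[of "ovoid_in L" "degenerate_extensions L"] by linarith
  qed
  then obtain R where R: "R \<in> ovoid_perp (L \<inter> perp L)" "R \<notin> ovoid_in L" "R \<notin> degenerate_extensions L"
    by blast
  then have R': "R \<in> \<O>" "\<not> R \<subseteq> L"
    by (auto simp: ovoid_perp_def ovoid_in_def)
  have "dim (span (L \<union> R) \<inter> perp (span (L \<union> R))) = 0"
    using radical_extension(2)[OF L(1) R(1) R'(2)] R R'(2) L(2) by (auto simp: degenerate_extensions_def)
  moreover have "dim (span (L \<union> R)) = 3" "card (ovoid_in (span (L \<union> R))) \<ge> 3"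
    using extension_by_ovoid_point[OF L(1) R'] L(3) t2 by auto
  ultimately show ?thesis
    by (intro exI[of _ "span (L \<union> R)"]) simp
qed

text \<open>Adding a degenerate extension raises the dimension and the radical by one each and adds
  at least one ovoid point, so the codimension \<open>3\<close> of the radical persists.\<close>

lemma exists_plane_cone:
  assumes "k + 3 \<le> d"
  shows "\<exists>W. subspace W \<and> dim (W \<inter> perp W) = k \<and> dim W = k + 3 \<and> card (ovoid_in W) \<ge> k + 3"
  using assms
proof (induction k)
  case 0
  then show ?case
    using exists_nondegenerate_plane by simp
next
  case (Suc k)
  then obtain W where W: "subspace W" "dim (W \<inter> perp W) = k" "dim W = k + 3" "card (ovoid_in W) \<ge> k + 3"
    by auto
  obtain P Q where PQ: "P \<in> ovoid_in W" "Q \<in> ovoid_in W" "P \<noteq> Q"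
    using exists_two_points[of "ovoid_in W"] W(4) by auto
  \<comment> \<open>The exponent is positive as \<open>Suc k + 3 \<le> d\<close>; thus a degenerate
    extension exists.\<close>
  have "int q ^ (2 * (d - k - 2)) > 1"
    using q_ge_2 Suc.prems by (intro one_less_power) auto
  moreover have "int q ^ 2 > 1"
    using q_ge_2 by (intro one_less_power) auto
  ultimately have "int (card (degenerate_extensions W)) > 0"
    using card_degenerate_extensions_plane(2)[OF W(1) PQ W(2,3)] Suc.prems by simp
  then obtain R where R: "R \<in> degenerate_extensions W"
    by (metis all_not_in_conv card.empty less_irrefl of_nat_0)
  then have R': "R \<in> \<O>" "\<not> R \<subseteq> W"
    "dim (span (W \<union> R) \<inter> perp (span (W \<union> R))) = Suc k"
    using W(2) by (auto simp: degenerate_extensions_def ovoid_perp_def)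
  then show ?case
    using extension_by_ovoid_point[OF W(1) R'(1,2)] W(3,4) by (intro exI[of _ "span (W \<union> R)"]) simp
qed

lemma rank_le: "int d \<le> int q ^ 3 - int q ^ 2 + 2"
proof (rule ccontr)
  assume large: "\<not> ?thesis"
  \<comment> \<open>With this \<open>k\<close> the cone has at least
    \<open>q ^ 3 - q ^ 2 + 3\<close> ovoid points, and the assumed size of \<open>d\<close> leaves
    room for it.\<close>
  define k where "k = nat (int q ^ 3 - int q ^ 2)"
  have "int q ^ 2 \<le> int q ^ 3"
    using q_ge_2 by (intro power_increasing) auto
  then have k: "int k = int q ^ 3 - int q ^ 2" "k + 3 \<le> d"
    using large by (auto simp: k_def)
  obtain W where W: "subspace W" "dim (W \<inter> perp W) = k" "dim W = k + 3" "card (ovoid_in W) \<ge> k + 3"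
    using exists_plane_cone[OF k(2)] by blast
  obtain P Q where PQ: "P \<in> ovoid_in W" "Q \<in> ovoid_in W" "P \<noteq> Q"
    using exists_two_points[of "ovoid_in W"] W(4) by auto
  define E where "E = int q ^ (2 * (d - k - 2))"
  define t where "t = int (card (ovoid_in W))"
  have E: "E \<ge> int q ^ 2" "int q ^ 2 > 0" "E \<ge> 0"
    using q_ge_2 k(2) unfolding E_def by (auto intro!: power_increasing)
  note count = card_degenerate_extensions_plane[OF W(1) PQ W(2,3) k(2), folded E_def t_def]
  have "ovoid_in W \<union> degenerate_extensions W \<subseteq> ovoid_perp (W \<inter> perp W)"
    using ovoid_in_subset by (auto simp: degenerate_extensions_def)
  then have "card (ovoid_in W \<union> degenerate_extensions W) \<le> card (ovoid_perp (W \<inter> perp W))"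
    by (rule card_mono[OF finite_sets])
  moreover have "card (ovoid_in W \<union> degenerate_extensions W) = card (ovoid_in W) + card (degenerate_extensions W)"
    using finite_sets by (intro card_Un_disjoint) (auto simp: ovoid_in_def degenerate_extensions_def)
  ultimately have "t + (E - 1) * (t + int q ^ 2 - 1) \<le> int q ^ 3 * E + 1"
    using count by (simp add: t_def)
  \<comment> \<open>The lower bound for \<open>t\<close> exceeds the coefficient of \<open>E\<close>
    here by \<open>2\<close>, so \<open>2 * E\<close> would be at most \<open>q ^ 2\<close>,
    although \<open>E\<close> is at least \<open>q ^ 2\<close>.\<close>
  then have "t * E \<le> (int q ^ 3 - int q ^ 2 + 1) * E + int q ^ 2"
    by (simp add: algebra_simps)
  moreover have "(int q ^ 3 - int q ^ 2 + 3) * E \<le> t * E"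
    using W(4) k(1) E by (intro mult_right_mono) (auto simp: t_def)
  ultimately have "2 * E \<le> int q ^ 2"
    by (simp add: algebra_simps)
  then show False
    using E by linarith
qed

end

theorem theorem6p3:
  fixes scale :: "'a::field \<Rightarrow> 'v::ab_group_add \<Rightarrow> 'v"
    and h :: "'v \<Rightarrow> 'v \<Rightarrow> 'a"
    and q d :: nat
  assumes "primepow q"
    and "int d > int q ^ 3 - int q ^ 2 + 2"
    and "hermitian_polar_space scale h q d"
  shows "\<not> (\<exists>\<O>. hermitian_polar_space.ovoid scale h d \<O>)"
proof
  assume "\<exists>\<O>. hermitian_polar_space.ovoid scale h d \<O>"
  then obtain \<O> where "hermitian_polar_space.ovoid scale h d \<O>"
    by blast
  then have "hermitian_ovoid scale h q d \<O>"
    using assms(3) by (intro hermitian_ovoid.intro hermitian_ovoid_axioms.intro)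
  then have "int d \<le> int q ^ 3 - int q ^ 2 + 2"
    by (rule hermitian_ovoid.rank_le)
  then show False
    using assms(2) by simp
qed

end
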